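(* Let $S$ be a nonempty finite set and let $A$ be a finite set with at least two elements. Let $\varepsilon\in A\triangleright(S\times G)$ be a teleo-environment that teleo-specifies the policy $\pi\in S\triangleright A$ among all policies, i.e. for every $\pi'\in S\triangleright A$, $\mathcal{S}(\pi',\varepsilon)\ge\mathcal{S}(\pi,\varepsilon)$ implies $\pi'=\pi$. Then for every $n$ and every valid evolution $(\star:(\mathbf{s}:\mathbf{t}:\mathbf{a}))\in(\{\star\}\times S\times G\times A)^n$ of the coupled system $c(\pi,\varepsilon)$, the evolution $(\star:(\mathbf{s}:\bot^n:\mathbf{a}))$ of $c(\pi,\varepsilon)$ is also valid.
   Context: For a finite set $X$, $P(X)$ is the set of probability distributions on $X$ and $\mathrm{supp}(p)$ is the support of $p\in P(X)$. For finite sets $I$ (inputs) and $O$ (outputs), the set $I \triangleright O$ of transducers is defined coinductively (it is the final coalgebra of $X \mapsto \sum_{p \in P(O)} (I \times \mathrm{supp}(p) \to X)$): a transducer $\pi$ is a pair $(\mathbb{P}_\pi, \mathbb{T}_\pi)$ with $\mathbb{P}_\pi \in P(O)$ and $\mathbb{T}_\pi : I \times \mathrm{supp}(\mathbb{P}_\pi) \to I \triangleright O$. Evolution: for strings $\mathbf{i}\in I^n$, $\mathbf{o}\in O^n$, $(\mathbf{i}:\mathbf{o})$ denotes the string of pairs $(\mathbf i_k,\mathbf o_k)$ (similarly for more strings). Evolution by the empty string is $\pi$, and $\pi \bullet (\mathbf{i}\cdot i : \mathbf{o} \cdot o) = \mathbb{T}_{\pi \bullet (\mathbf{i}:\mathbf{o})}(i,o)$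 if $\pi\bullet(\mathbf{i}:\mathbf{o})$ is defined and $o \in \mathrm{supp}(\mathbb{P}_{\pi\bullet(\mathbf{i}:\mathbf{o})})$; otherwise it is undefined. An evolution is valid if it is defined. Let $G = \{\bot,\top\}$ ($\top$ = success). A policy is an element of $S\triangleright A$; a teleo-environment is an element of $A \triangleright (S\times G)$; $\bot^n$ is the string of $n$ copies of $\bot$. The coupling $c(\pi,\varepsilon)\in\{\star\}\triangleright(S\times G\times A)$ is defined corecursively by $\mathbb{P}_{c(\pi,\varepsilon)}(s,t,a)=\mathbb{P}_\pi(a)\mathbb{P}_\varepsilon(s,t)$ and $\mathbb{T}_{c(\pi,\varepsilon)}(\star,(s,t,a))=c\big(\mathbb{T}_\pi(s,a),\mathbb{T}_\varepsilon(a,(s,t))\big)$; in trajectories of a coupled system the input string consists only of $\star$'s. The success probability $\mathcal{S}(\pi,\varepsilon)$ is $\lim_{n\to\infty} \mathcal{S}_n(\pi,\varepsilon)$, where $\mathcal{S}_0(\pi,\varepsilon) = \sum_{s\in S} \mathbb{P}_\varepsilon(s,\top)$ and $\mathcal{S}_{n+1}(\pi,\varepsilon) = \sum_{s\in S}\sum_{a\in A} \left[\mathbb{P}_\pi(a)\mathbb{P}_\varepsilon(s,\top) + \mathbb{P}_\pi(a)\mathbb{P}_\varepsilon(s,\bot)\, \mathcal{S}_n\big(\mathbb{T}_\pi(s,a), \mathbb{T}_\varepsilon(a,(s,\bot))\big)\right]$ (terms with zero coefficient are omitted). *)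

theory Defs
  imports "HOL-Probability.Probability_Mass_Function"
begin

section \<open>Transducers\<close>

text \<open>
  The codatatype below allows arbitrary partial transition functions.  The set of transducers
  with inputs \<open>'i\<close> and outputs \<open>'o\<close> is the subset \<open>transducers\<close> of those trees in which every
  transition function is defined exactly on \<open>'i\<close> times the support of the output distribution.
  Since transitions outside the support are always \<open>None\<close>, equality of elements of
  \<open>transducers\<close> is equality in the final coalgebra; see \<open>transducers_final\<close>.
\<close>

codatatype ('i, 'o) transducer =
  Transducer (out_dist: "'o pmf") (transition: "'i \<Rightarrow> 'o \<Rightarrow> ('i, 'o) transducer option")

coinductive_set transducers :: "('i, 'o) transducer set" where
  "\<lbrakk>\<And>i x. transition \<pi> i x \<noteq> None \<longleftrightarrow> x \<in> set_pmf (out_dist \<pi>);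
    \<And>i x \<rho>. transition \<pi> i x = Some \<rho> \<Longrightarrow> \<rho> \<in> transducers\<rbrakk>
   \<Longrightarrow> \<pi> \<in> transducers"

lemma transition_defined_iff:
  "\<pi> \<in> transducers \<Longrightarrow> transition \<pi> i x \<noteq> None \<longleftrightarrow> x \<in> set_pmf (out_dist \<pi>)"
  by (erule transducers.cases) blast

lemma transition_in_transducers:
  "\<pi> \<in> transducers \<Longrightarrow> transition \<pi> i x = Some \<rho> \<Longrightarrow> \<rho> \<in> transducers"
  by (erule transducers.cases) blast

primcorec unfold_transducer ::
  "('x \<Rightarrow> 'o pmf) \<Rightarrow> ('x \<Rightarrow> 'i \<Rightarrow> 'o \<Rightarrow> 'x option) \<Rightarrow> 'x \<Rightarrow> ('i, 'o) transducer" where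
  "out_dist (unfold_transducer p t x) = p x"
| "transition (unfold_transducer p t x) = (\<lambda>i y. map_option (unfold_transducer p t) (t x i y))"

lemma transducers_final:
  fixes p :: "'x \<Rightarrow> 'o pmf" and t :: "'x \<Rightarrow> 'i \<Rightarrow> 'o \<Rightarrow> 'x option"
  assumes dom: "\<And>x i y. t x i y \<noteq> None \<longleftrightarrow> y \<in> set_pmf (p x)"
  shows "\<exists>!h :: 'x \<Rightarrow> ('i, 'o) transducer. (\<forall>x. h x \<in> transducers) \<and>
    (\<forall>x. out_dist (h x) = p x \<and> (\<forall>i y. transition (h x) i y = map_option h (t x i y)))"
proof (rule ex1I)
  let ?h = "unfold_transducer p t"
  have "?h x \<in> transducers" for x
  proof (coinduction arbitrary: x)
    case transducers
    then show ?case using dom by fastforce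
  qed
  then show "(\<forall>x. ?h x \<in> transducers) \<and>
    (\<forall>x. out_dist (?h x) = p x \<and> (\<forall>i y. transition (?h x) i y = map_option ?h (t x i y)))"
    by simp
next
  fix h :: "'x \<Rightarrow> ('i, 'o) transducer"
  assume h: "(\<forall>x. h x \<in> transducers) \<and>
    (\<forall>x. out_dist (h x) = p x \<and> (\<forall>i y. transition (h x) i y = map_option h (t x i y)))"
  have "h x = unfold_transducer p t x" for x
  proof (coinduction arbitrary: x)
    case Eq_transducer
    then show ?case
      using h by (auto simp: rel_fun_def option_rel_Some1 option.rel_map intro!: option.rel_refl_strong)
  qed
  then show "h = unfold_transducer p t" by blast
qed

section \<open>Evolution\<close>

text \<open>The result is \<open>None\<close> when the evolution is undefined.\<close>

definition evolve :: "('i, 'o) transducer \<Rightarrow> ('i \<times> 'o) list \<Rightarrow> ('i, 'o) transducer option" where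
  "evolve \<pi> = foldl
     (\<lambda>r (i, x). case r of None \<Rightarrow> None
        | Some \<rho> \<Rightarrow> if x \<in> set_pmf (out_dist \<rho>) then transition \<rho> i x else None)
     (Some \<pi>)"

lemma evolve_Nil: "evolve \<pi> [] = Some \<pi>"
  by (simp add: evolve_def)

lemma evolve_snoc:
  "evolve \<pi> (h @ [(i, x)]) =
     (case evolve \<pi> h of None \<Rightarrow> None
        | Some \<rho> \<Rightarrow> if x \<in> set_pmf (out_dist \<rho>) then transition \<rho> i x else None)"
  by (simp add: evolve_def)

definition valid_evolution :: "('i, 'o) transducer \<Rightarrow> ('i \<times> 'o) list \<Rightarrow> bool" where
  "valid_evolution \<pi> h \<longleftrightarrow> evolve \<pi> h \<noteq> None"

section \<open>Policies, teleo-environments and their coupling\<close>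

text \<open>\<open>True\<close> stands for success, \<open>False\<close> for no success.\<close>

type_synonym goal = bool

type_synonym ('s, 'a) policy = "('s, 'a) transducer"
type_synonym ('s, 'a) teleo_env = "('a, 's \<times> goal) transducer"

primcorec coupling ::
  "('s, 'a) policy \<Rightarrow> ('s, 'a) teleo_env \<Rightarrow> (unit, 's \<times> goal \<times> 'a) transducer" where
  "out_dist (coupling \<pi> \<epsilon>) = map_pmf (\<lambda>(a, (s, t)). (s, t, a)) (pair_pmf (out_dist \<pi>) (out_dist \<epsilon>))"
| "transition (coupling \<pi> \<epsilon>) =
     (\<lambda>_ (s, t, a). map_option (\<lambda>(\<pi>', \<epsilon>'). coupling \<pi>' \<epsilon>')
        (case (transition \<pi> s a, transition \<epsilon> a (s, t)) of
           (Some \<pi>', Some \<epsilon>') \<Rightarrow> Some (\<pi>', \<epsilon>') | _ \<Rightarrow> None))"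

lemma pmf_out_dist_coupling:
  fixes \<pi> :: "('s, 'a) policy" and \<epsilon> :: "('s, 'a) teleo_env"
  shows "pmf (out_dist (coupling \<pi> \<epsilon>)) (s, t, a) = pmf (out_dist \<pi>) a * pmf (out_dist \<epsilon>) (s, t)"
proof -
  have "inj (\<lambda>(a :: 'a, (s :: 's, t :: goal)). (s, t, a))"
    by (auto simp: inj_def)
  from pmf_map_inj'[OF this, of "pair_pmf (out_dist \<pi>) (out_dist \<epsilon>)" "(a, (s, t))"]
  show ?thesis by (simp add: pmf_pair)
qed

lemma transition_coupling:
  assumes "transition \<pi> s a = Some \<pi>'" and "transition \<epsilon> a (s, t) = Some \<epsilon>'"
  shows "transition (coupling \<pi> \<epsilon>) () (s, t, a) = Some (coupling \<pi>' \<epsilon>')"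
  using assms by simp

lemma coupling_in_transducers:
  assumes "\<pi> \<in> transducers" and "\<epsilon> \<in> transducers"
  shows "coupling \<pi> \<epsilon> \<in> transducers"
  using assms
proof (coinduction arbitrary: \<pi> \<epsilon>)
  case transducers
  note dom = transition_defined_iff[OF transducers(1)] transition_defined_iff[OF transducers(2)]
  note closed = transition_in_transducers[OF transducers(1)]
    transition_in_transducers[OF transducers(2)]
  have "transition (coupling \<pi> \<epsilon>) i x \<noteq> None \<longleftrightarrow> x \<in> set_pmf (out_dist (coupling \<pi> \<epsilon>))"
    for i x
  proof (cases x)
    case (fields s t a)
    show ?thesis
      using dom(1)[of s a] dom(2)[of a "(s, t)"]
      by (force simp: fields image_iff split: option.splits)
  qed
  moreover have "\<exists>\<pi>' \<epsilon>'. \<rho> = coupling \<pi>' \<epsilon>' \<and> \<pi>' \<in> transducers \<and> \<epsilon>' \<in> transducers"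
    if "transition (coupling \<pi> \<epsilon>) i x = Some \<rho>" for i x \<rho>
    using that by (cases x) (auto split: option.splits intro!: exI conjI closed)
  ultimately show ?case by blast
qed

section \<open>Success probability and teleo-specification\<close>

text \<open>
  Where \<open>the\<close> is applied to an undefined transition, the coefficient in front is zero.
\<close>

primrec success_prob_upto ::
  "nat \<Rightarrow> ('s :: finite, 'a :: finite) policy \<Rightarrow> ('s, 'a) teleo_env \<Rightarrow> real" where
  "success_prob_upto 0 = (\<lambda>\<pi> \<epsilon>. \<Sum>s\<in>UNIV. pmf (out_dist \<epsilon>) (s, True))"
| "success_prob_upto (Suc n) = (\<lambda>\<pi> \<epsilon>. \<Sum>s\<in>UNIV. \<Sum>a\<in>UNIV.
     pmf (out_dist \<pi>) a * pmf (out_dist \<epsilon>) (s, True) +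
     pmf (out_dist \<pi>) a * pmf (out_dist \<epsilon>) (s, False) *
       success_prob_upto n (the (transition \<pi> s a)) (the (transition \<epsilon> a (s, False))))"

definition success_prob ::
  "('s :: finite, 'a :: finite) policy \<Rightarrow> ('s, 'a) teleo_env \<Rightarrow> real" where
  "success_prob \<pi> \<epsilon> = lim (\<lambda>n. success_prob_upto n \<pi> \<epsilon>)"

lemma success_prob_upto_bounds:
  fixes \<pi> :: "('s :: finite, 'a :: finite) policy" and \<epsilon> :: "('s, 'a) teleo_env"
  shows "0 \<le> success_prob_upto n \<pi> \<epsilon> \<and> success_prob_upto n \<pi> \<epsilon> \<le> 1"
proof (induction n arbitrary: \<pi> \<epsilon>)
  have total: "(\<Sum>s\<in>UNIV. pmf (out_dist \<epsilon>) (s, True) + pmf (out_dist \<epsilon>) (s, False)) = 1"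
    for \<epsilon> :: "('s, 'a) teleo_env"
  proof -
    have "(\<Sum>s\<in>UNIV. pmf (out_dist \<epsilon>) (s, True) + pmf (out_dist \<epsilon>) (s, False)) =
        (\<Sum>s\<in>UNIV. \<Sum>t\<in>UNIV. pmf (out_dist \<epsilon>) (s, t))"
      by (simp add: UNIV_bool add.commute)
    also have "\<dots> = (\<Sum>x\<in>UNIV. pmf (out_dist \<epsilon>) x)"
      by (simp add: sum.cartesian_product)
    also have "\<dots> = 1" by (rule sum_pmf_eq_1) auto
    finally show ?thesis .
  qed
  {
    case 0
    have "(\<Sum>s\<in>UNIV. pmf (out_dist \<epsilon>) (s, True)) \<le> 1"
      unfolding total[of \<epsilon>, symmetric] by (rule sum_mono) simp
    then show ?case by (simp add: sum_nonneg)
  next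
    case (Suc n)
    let ?u = "\<lambda>s a. pmf (out_dist \<pi>) a * pmf (out_dist \<epsilon>) (s, True) +
      pmf (out_dist \<pi>) a * pmf (out_dist \<epsilon>) (s, False) *
        success_prob_upto n (the (transition \<pi> s a)) (the (transition \<epsilon> a (s, False)))"
    have "?u s a \<le> pmf (out_dist \<pi>) a * (pmf (out_dist \<epsilon>) (s, True) + pmf (out_dist \<epsilon>) (s, False))"
      for s a
      using Suc.IH by (simp add: distrib_left mult_left_le)
    then have "(\<Sum>s\<in>UNIV. \<Sum>a\<in>UNIV. ?u s a) \<le> (\<Sum>s\<in>UNIV. \<Sum>a\<in>UNIV.
        pmf (out_dist \<pi>) a * (pmf (out_dist \<epsilon>) (s, True) + pmf (out_dist \<epsilon>) (s, False)))"
      by (intro sum_mono)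
    also have "\<dots> = (\<Sum>s\<in>UNIV. pmf (out_dist \<epsilon>) (s, True) + pmf (out_dist \<epsilon>) (s, False))"
      by (simp add: sum_distrib_right[symmetric] sum_pmf_eq_1)
    also have "\<dots> = 1" by (rule total)
    finally have "success_prob_upto (Suc n) \<pi> \<epsilon> \<le> 1" by simp
    moreover have "0 \<le> success_prob_upto (Suc n) \<pi> \<epsilon>"
      using Suc.IH by (simp add: sum_nonneg)
    ultimately show ?case by blast
  }
qed

lemma success_prob_upto_mono:
  "success_prob_upto n \<pi> \<epsilon> \<le> success_prob_upto (Suc n) \<pi> \<epsilon>"
proof (induction n arbitrary: \<pi> \<epsilon>)
  case 0
  have "(\<Sum>s\<in>UNIV. pmf (out_dist \<epsilon>) (s, True)) =
      (\<Sum>s\<in>UNIV. \<Sum>a\<in>UNIV. pmf (out_dist \<pi>) a * pmf (out_dist \<epsilon>) (s, True))"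
    by (simp add: sum_distrib_right[symmetric] sum_pmf_eq_1)
  also have "\<dots> \<le> success_prob_upto (Suc 0) \<pi> \<epsilon>"
    by (auto intro!: sum_mono mult_nonneg_nonneg sum_nonneg)
  finally show ?case by simp
next
  case (Suc n)
  show ?case
    unfolding success_prob_upto.simps(2)[of "Suc n"] success_prob_upto.simps(2)[of n]
    by (intro sum_mono add_left_mono mult_left_mono
        Suc.IH[unfolded success_prob_upto.simps(2)]) auto
qed

lemma success_prob_upto_tendsto:
  "(\<lambda>n. success_prob_upto n \<pi> \<epsilon>) \<longlonglongrightarrow> success_prob \<pi> \<epsilon>"
proof -
  have "incseq (\<lambda>n. success_prob_upto n \<pi> \<epsilon>)"
    by (intro incseq_SucI success_prob_upto_mono)
  then have "convergent (\<lambda>n. success_prob_upto n \<pi> \<epsilon>)"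
    using success_prob_upto_bounds by (metis incseq_convergent convergent_def)
  then show ?thesis
    unfolding success_prob_def by (simp add: convergent_LIMSEQ_iff)
qed

definition teleo_specifies ::
  "('s :: finite, 'a :: finite) teleo_env \<Rightarrow> ('s, 'a) policy \<Rightarrow> ('s, 'a) policy set \<Rightarrow> bool" where
  "teleo_specifies \<epsilon> \<pi> C \<longleftrightarrow>
     (\<forall>\<pi>'\<in>C. success_prob \<pi>' \<epsilon> \<ge> success_prob \<pi> \<epsilon> \<longrightarrow> \<pi>' = \<pi>)"

end

theory Submission
  imports Defs
begin

text \<open>
  Replacing the continuation of the policy after its first action \<open>a\<close> and observation \<open>s\<close> changes
  the success probability only through the summand with coefficient \<open>P\<^sub>\<pi>(a) P\<^sub>\<epsilon>(s, \<bottom>)\<close>. If \<open>\<epsilon>\<close>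
  teleo-specifies \<open>\<pi>\<close> and \<open>a\<close> is possible, then \<open>(s, \<bottom>)\<close> is therefore possible too, since otherwise
  the continuation could be chosen freely, and the residual environment after \<open>(s, \<bottom>)\<close>
  teleo-specifies the residual policy. The residual policy does not see the goal component, so this
  can be iterated along the given trajectory, whatever its goal components are.
\<close>

text \<open>As a left fold, \<open>evolve\<close> recurses at the end of the string; the first pair
  can be split off because \<open>None\<close> is absorbing.\<close>

lemma evolve_Cons:
  "evolve \<pi> ((i, x) # h) =
     (if x \<in> set_pmf (out_dist \<pi>)
      then case transition \<pi> i x of None \<Rightarrow> None | Some \<rho> \<Rightarrow> evolve \<rho> h
      else None)"
proof -
  have "foldl (\<lambda>r (i, x). case r of None \<Rightarrow> None
        | Some \<rho> \<Rightarrow> if x \<in> set_pmf (out_dist \<rho>) then transition \<rho> i x else None) None h = None"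
    by (induction h) auto
  then show ?thesis by (auto simp: evolve_def split: option.split)
qed

lemma valid_evolution_Nil: "valid_evolution \<pi> []"
  by (simp add: valid_evolution_def evolve_Nil)

text \<open>Within \<open>transducers\<close> a transition of the coupling is defined exactly on the
  support, so the support test in \<open>evolve\<close> reduces to definedness of both component
  transitions.\<close>

lemma valid_evolution_coupling_Cons:
  assumes "\<pi> \<in> transducers" and "\<epsilon> \<in> transducers"
  shows "valid_evolution (coupling \<pi> \<epsilon>) (((), s, t, a) # h) \<longleftrightarrow>
    (\<exists>\<pi>' \<epsilon>'. transition \<pi> s a = Some \<pi>' \<and> transition \<epsilon> a (s, t) = Some \<epsilon>' \<and>
      valid_evolution (coupling \<pi>' \<epsilon>') h)"
  using transition_defined_iff[OF coupling_in_transducers[OF assms], of "()" "(s, t, a)"]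
  by (auto simp: valid_evolution_def evolve_Cons split: option.splits
      simp del: coupling.simps(1))

text \<open>The recursion for \<open>success_prob_upto\<close> passes to the limit because the sums
  are finite and convergence holds for arbitrary trees, hence also for \<open>the\<close> of an
  undefined transition.\<close>

lemma success_prob_unfold:
  "success_prob \<pi> \<epsilon> = (\<Sum>s\<in>UNIV. \<Sum>a\<in>UNIV.
     pmf (out_dist \<pi>) a * pmf (out_dist \<epsilon>) (s, True) +
     pmf (out_dist \<pi>) a * pmf (out_dist \<epsilon>) (s, False) *
       success_prob (the (transition \<pi> s a)) (the (transition \<epsilon> a (s, False))))"
proof (rule LIMSEQ_unique)
  show "(\<lambda>n. success_prob_upto (Suc n) \<pi> \<epsilon>) \<longlonglongrightarrow> success_prob \<pi> \<epsilon>"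
    by (rule LIMSEQ_Suc[OF success_prob_upto_tendsto])
  show "(\<lambda>n. success_prob_upto (Suc n) \<pi> \<epsilon>) \<longlonglongrightarrow> (\<Sum>s\<in>UNIV. \<Sum>a\<in>UNIV.
     pmf (out_dist \<pi>) a * pmf (out_dist \<epsilon>) (s, True) +
     pmf (out_dist \<pi>) a * pmf (out_dist \<epsilon>) (s, False) *
       success_prob (the (transition \<pi> s a)) (the (transition \<epsilon> a (s, False))))"
    unfolding success_prob_upto.simps by (intro tendsto_intros success_prob_upto_tendsto)
qed

text \<open>Exchange argument with \<open>\<rho>\<close> grafted in place of \<open>\<pi>1\<close>.
  The condition in \<open>ge\<close> lets it cover two cases: failure with \<open>s\<close>
  impossible, where \<open>\<rho>\<close> is arbitrary, and failure possible, where
  \<open>\<rho>\<close> competes with \<open>\<pi>1\<close> in the residual environment.\<close>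

lemma teleo_specifies_continuation_unique:
  fixes \<epsilon> :: "('s :: finite, 'a :: finite) teleo_env"
  assumes spec: "teleo_specifies \<epsilon> \<pi> transducers"
    and \<pi>: "\<pi> \<in> transducers" and \<pi>1: "transition \<pi> s a = Some \<pi>1"
    and \<rho>: "\<rho> \<in> transducers"
    and ge: "(s, False) \<in> set_pmf (out_dist \<epsilon>) \<Longrightarrow>
      success_prob \<rho> (the (transition \<epsilon> a (s, False))) \<ge>
      success_prob \<pi>1 (the (transition \<epsilon> a (s, False)))"
  shows "\<rho> = \<pi>1"
proof -
  define \<pi>' where "\<pi>' = Transducer (out_dist \<pi>)
    (\<lambda>s' a'. if s' = s \<and> a' = a then Some \<rho> else transition \<pi> s' a')"
  have "\<pi>' \<in> transducers"
  proof (rule transducers.intros)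
    \<comment> \<open>Since \<open>\<pi>1\<close> exists, \<open>a\<close> lies in the support, so
      grafting leaves the domain unchanged.\<close>
    show "transition \<pi>' s' a' \<noteq> None \<longleftrightarrow> a' \<in> set_pmf (out_dist \<pi>')" for s' a'
      using transition_defined_iff[OF \<pi>, of s' a'] \<pi>1 by (auto simp: \<pi>'_def)
    show "\<sigma> \<in> transducers" if "transition \<pi>' s' a' = Some \<sigma>" for s' a' \<sigma>
      using that \<rho> transition_in_transducers[OF \<pi>, of s' a']
      by (auto simp: \<pi>'_def split: if_splits)
  qed
  moreover have "success_prob \<pi> \<epsilon> \<le> success_prob \<pi>' \<epsilon>"
    unfolding success_prob_unfold[of \<pi>] success_prob_unfold[of \<pi>']
  proof (intro sum_mono)
    \<comment> \<open>If \<open>(s', False)\<close> is impossible, the continuation terms vanish on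
      both sides; otherwise only the summand at \<open>(s, a)\<close> can differ, and
      \<open>ge\<close> bounds it.\<close>
    fix s' a'
    show "pmf (out_dist \<pi>) a' * pmf (out_dist \<epsilon>) (s', True) +
        pmf (out_dist \<pi>) a' * pmf (out_dist \<epsilon>) (s', False) *
          success_prob (the (transition \<pi> s' a')) (the (transition \<epsilon> a' (s', False))) \<le>
      pmf (out_dist \<pi>') a' * pmf (out_dist \<epsilon>) (s', True) +
        pmf (out_dist \<pi>') a' * pmf (out_dist \<epsilon>) (s', False) *
          success_prob (the (transition \<pi>' s' a')) (the (transition \<epsilon> a' (s', False)))"
      using ge \<pi>1
      by (cases "(s', False) \<in> set_pmf (out_dist \<epsilon>)")
        (auto simp: \<pi>'_def set_pmf_eq intro!: mult_left_mono)
  qed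
  ultimately have "\<pi>' = \<pi>"
    using spec by (simp add: teleo_specifies_def)
  then show ?thesis
    using \<pi>1 by (auto simp: \<pi>'_def dest!: arg_cong[of _ _ "\<lambda>\<sigma>. transition \<sigma> s a"])
qed

text \<open>Emitting \<open>x\<close> forever and emitting \<open>y\<close> forever are different
  transducers, so at most one of them is \<open>\<pi>\<close>.\<close>

lemma exists_different_transducer:
  fixes \<pi> :: "('i, 'o) transducer"
  assumes "(x :: 'o) \<noteq> y"
  shows "\<exists>\<rho>\<in>transducers. \<rho> \<noteq> \<pi>"
proof -
  have "\<exists>!h :: 'o \<Rightarrow> ('i, 'o) transducer. (\<forall>z. h z \<in> transducers) \<and>
    (\<forall>z. out_dist (h z) = return_pmf z \<and>
      (\<forall>i w. transition (h z) i w = map_option h (if w = z then Some z else None)))"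
    by (rule transducers_final) simp
  then obtain h :: "'o \<Rightarrow> ('i, 'o) transducer"
    where "\<And>z. h z \<in> transducers" "\<And>z. out_dist (h z) = return_pmf z"
    by blast
  then show ?thesis
    using assms by (metis return_pmf_inj)
qed

text \<open>If failure with \<open>s\<close> were impossible, the premise \<open>ge\<close> of the
  exchange argument would be vacuous and every policy would equal \<open>\<pi>1\<close>; two
  distinct actions yield a policy that does not.\<close>

lemma teleo_specifies_failure_possible:
  fixes \<epsilon> :: "('s :: finite, 'a :: finite) teleo_env"
  assumes "CARD('a) \<ge> 2" and "teleo_specifies \<epsilon> \<pi> transducers"
    and "\<pi> \<in> transducers" and "transition \<pi> s a = Some \<pi>1"
  shows "(s, False) \<in> set_pmf (out_dist \<epsilon>)"
proof -
  obtain x y :: 'a where "x \<noteq> y"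
    using assms(1) by (metis card_2_iff' ex_card)
  from exists_different_transducer[OF this, of \<pi>1]
  obtain \<rho> where \<rho>: "\<rho> \<in> transducers" "\<rho> \<noteq> \<pi>1"
    by (elim bexE)
  show ?thesis
  proof (rule ccontr)
    assume "(s, False) \<notin> set_pmf (out_dist \<epsilon>)"
    with \<rho> show False
      using teleo_specifies_continuation_unique[OF assms(2-4) \<rho>(1)] by simp
  qed
qed

lemma teleo_specifies_continuation:
  fixes \<epsilon> :: "('s :: finite, 'a :: finite) teleo_env"
  assumes "teleo_specifies \<epsilon> \<pi> transducers" and "\<pi> \<in> transducers"
    and "transition \<pi> s a = Some \<pi>1" and "transition \<epsilon> a (s, False) = Some \<epsilon>1"
  shows "teleo_specifies \<epsilon>1 \<pi>1 transducers"
  using teleo_specifies_continuation_unique[OF assms(1-3)] assms(4)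
  by (simp add: teleo_specifies_def)

text \<open>The induction needs two environments: \<open>\<epsilon>'\<close> follows the given
  trajectory and \<open>\<epsilon>\<close> the one without successes. They may diverge once some
  \<open>t\<close> is \<open>True\<close>, while the policy stays common to both;
  teleo-specification is carried along for \<open>\<epsilon>\<close> only.\<close>

lemma valid_evolution_without_success:
  fixes \<epsilon> \<epsilon>' :: "('s :: finite, 'a :: finite) teleo_env" and \<pi> :: "('s, 'a) policy"
  assumes card: "CARD('a) \<ge> 2"
    and "length ss = length ts" and "length ts = length as"
    and "\<epsilon> \<in> transducers" and "\<epsilon>' \<in> transducers" and "\<pi> \<in> transducers"
    and "teleo_specifies \<epsilon> \<pi> transducers"
    and "valid_evolution (coupling \<pi> \<epsilon>') (zip (replicate (length as) ()) (zip ss (zip ts as)))"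
  shows "valid_evolution (coupling \<pi> \<epsilon>)
    (zip (replicate (length as) ()) (zip ss (zip (replicate (length as) False) as)))"
  using assms(2-)
proof (induction ss ts as arbitrary: \<pi> \<epsilon> \<epsilon>' rule: list_induct3)
  case Nil
  then show ?case by (simp add: valid_evolution_Nil)
next
  case (Cons s ss t ts a as)
  note spec = Cons.prems(4)
  from Cons.prems obtain \<pi>1 \<epsilon>1' where \<pi>1: "transition \<pi> s a = Some \<pi>1"
    and \<epsilon>1': "transition \<epsilon>' a (s, t) = Some \<epsilon>1'"
    and valid: "valid_evolution (coupling \<pi>1 \<epsilon>1')
      (zip (replicate (length as) ()) (zip ss (zip ts as)))"
    by (auto simp: valid_evolution_coupling_Cons)
  \<comment> \<open>The given trajectory enters only through \<open>\<pi>1\<close>, which witnesses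
    that \<open>a\<close> is possible; that \<open>(s, False)\<close> is possible comes from
    teleo-specification.\<close>
  from teleo_specifies_failure_possible[OF card spec Cons.prems(3) \<pi>1]
  obtain \<epsilon>1 where \<epsilon>1: "transition \<epsilon> a (s, False) = Some \<epsilon>1"
    using transition_defined_iff[OF Cons.prems(1), of a "(s, False)"] by auto
  have "valid_evolution (coupling \<pi>1 \<epsilon>1)
    (zip (replicate (length as) ()) (zip ss (zip (replicate (length as) False) as)))"
    using Cons.prems(1-3) \<pi>1 \<epsilon>1 \<epsilon>1' valid teleo_specifies_continuation[OF spec Cons.prems(3) \<pi>1 \<epsilon>1]
    by (intro Cons.IH) (auto intro: transition_in_transducers)
  then show ?case
    using Cons.prems(1,3) \<pi>1 \<epsilon>1 by (simp add: valid_evolution_coupling_Cons)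
qed

theorem proposition6p1p1:
  fixes \<epsilon> :: "('s :: finite, 'a :: finite) teleo_env" and \<pi> :: "('s, 'a) policy"
    and n :: nat and ss :: "'s list" and ts :: "goal list" and as :: "'a list"
  assumes "CARD('a) \<ge> 2"
    and "\<epsilon> \<in> transducers" and "\<pi> \<in> transducers"
    and "teleo_specifies \<epsilon> \<pi> transducers"
    and "length ss = n" and "length ts = n" and "length as = n"
    and "valid_evolution (coupling \<pi> \<epsilon>) (zip (replicate n ()) (zip ss (zip ts as)))"
  shows "valid_evolution (coupling \<pi> \<epsilon>)
    (zip (replicate n ()) (zip ss (zip (replicate n False) as)))"
  \<comment> \<open>Both trajectories start in the same environment.\<close>
  using valid_evolution_without_success[of ss ts as \<epsilon> \<epsilon> \<pi>] assms by simp

end
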